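(* For every integer $n\ge 1$, the number of labeled interval orders on $[n]$ equals $$\sum_{\{s_1,\dots,s_k\}\subseteq [n-1]}\left(\det\left[\binom{n-s_i}{s_{j+1}-s_i}\right]_{(i,j)\in[0,k]\times[0,k]}\cdot\prod_{r=1}^{k+1} r^{\,s_r-s_{r-1}}\right),$$ where the sum is over all subsets of $[n-1]$ (including the empty one, with $k=0$), the elements of each subset are indexed so that $s_1<s_2<\dots<s_k$, and $s_0=0$, $s_{k+1}=n$.
   Context: $[n]=\{1,\dots,n\}$ and $[0,k]=\{0,1,\dots,k\}$. A binomial coefficient $\binom{a}{b}$ with $b<0$ is $0$. A poset $P$ is an interval order if each $z\in P$ can be assigned a closed real interval $[l_z,r_z]$ such that $x<_P y$ if and only if $r_x<l_y$. A labeled interval order on $[n]$ is a partial order on the set $[n]$ that is an interval order (two such are the same only if they are equal as relations on $[n]$). *)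

theory Defs
  imports Complex_Main "Jordan_Normal_Form.Determinant"
begin

text \<open>
  A partial order on \<open>A\<close> is a reflexive relation (the library's \<^const>\<open>partial_order_on\<close>);
  the strict order \<open>x <\<^sub>P y\<close> is \<open>(x, y) \<in> P\<close> together with \<open>x \<noteq> y\<close>.
  The closed interval assigned to \<open>z\<close> is \<open>[lo z, hi z]\<close>.
\<close>

definition interval_order_on :: "'a set \<Rightarrow> 'a rel \<Rightarrow> bool" where
  "interval_order_on A P \<longleftrightarrow>
     partial_order_on A P \<and>
     (\<exists>lo hi :: 'a \<Rightarrow> real.
        (\<forall>z\<in>A. lo z \<le> hi z) \<and>
        (\<forall>x\<in>A. \<forall>y\<in>A. ((x, y) \<in> P \<and> x \<noteq> y) \<longleftrightarrow> hi x < lo y))"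

definition labeled_interval_orders :: "nat \<Rightarrow> nat rel set" where
  "labeled_interval_orders n = {P. interval_order_on {1..n} P}"

definition binom :: "nat \<Rightarrow> int \<Rightarrow> int" where
  "binom a b = (if b < 0 then 0 else int (a choose nat b))"

text \<open>
  For \<open>S = {s\<^sub>1 < \<dots> < s\<^sub>k}\<close>, \<open>breakpoint n S i\<close> is \<open>s\<^sub>i\<close> for \<open>0 \<le> i \<le> k + 1\<close>,
  with \<open>s\<^sub>0 = 0\<close> and \<open>s\<^bsub>k+1\<^esub> = n\<close>.
\<close>

definition breakpoint :: "nat \<Rightarrow> nat set \<Rightarrow> nat \<Rightarrow> nat" where
  "breakpoint n S i = (0 # sorted_list_of_set S @ [n]) ! i"

text \<open>
  Matrix rows and columns are indexed from 0, as in \<open>[0,k] \<times> [0,k]\<close>.  The natural-number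
  subtraction \<open>n - s\<^sub>i\<close> never truncates since \<open>s\<^sub>i \<le> n\<close>.
\<close>

definition binom_matrix :: "nat \<Rightarrow> nat set \<Rightarrow> int mat" where
  "binom_matrix n S =
     mat (card S + 1) (card S + 1)
       (\<lambda>(i, j). binom (n - breakpoint n S i)
                       (int (breakpoint n S (j + 1)) - int (breakpoint n S i)))"

end

theory Submission
  imports Defs "HOL-Computational_Algebra.Formal_Power_Series" "HOL-Library.FuncSet"
begin

text \<open>
  Both sides equal \<open>n!\<close> times the coefficient of \<open>x\<^sup>n\<close> in
  \<open>\<Sum>m. F\<^sub>m\<close>, where \<open>F\<^sub>m = \<Prod>i=1..m. (1 - exp (- i x))\<close>.

  Every interval order has a unique representation by intervals with endpoints in \<open>{1..m}\<close>
  such that each point is both a left and a right endpoint.  Removing the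
  intervals with smallest right endpoint, while \<open>q\<close> freely usable left labels accumulate,
  gives the generating functions \<open>Z\<^sub>m(q)\<close> of such representations the recursion
  \<open>Z\<^sub>m\<^sub>+\<^sub>1(q) = (exp ((q + 1) x) - 1) Z\<^sub>m(q + 1) - (exp (q x) - 1) Z\<^sub>m(q)\<close>; summed over \<open>m\<close>,
  \<open>X(q) = exp (q x) \<Sum>m. Z\<^sub>m(q)\<close> satisfies
  \<open>X(q) = 1 + (1 - exp (- (q + 1) x)) X(q + 1)\<close>, whence \<open>X(0) = \<Sum>m. F\<^sub>m\<close>.

  On the other side, each matrix is upper Hessenberg with unit subdiagonal, so that expanding
  along the first column either splits off \<open>s\<^sub>1\<close> or deletes it.  Let the weights of the runs
  start at \<open>q\<close> instead of \<open>1\<close>.  Deciding the membership of one position at a time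
  turns the sum into a recursion that is a combination of the operator
  \<open>p(q) \<mapsto> q (p(q) - p(q + 1))\<close>, for which \<open>q + m - 1 choose m\<close> is an eigenvector with eigenvalue
  \<open>- m\<close>, and of \<open>p(q) \<mapsto> q p(q + 1)\<close>, which raises \<open>m\<close>.  In that basis the coefficients are
  those of \<open>F\<^sub>m\<close>, and at \<open>q = 1\<close> all basis elements are \<open>1\<close>.
\<close>

no_notation vec_index (infixl "$" 100)
notation fps_nth (infixl "$" 75)

section \<open>Exponential generating functions\<close>

text \<open>Binomial convolution; the term \<open>i = 0\<close> is absent because
  \<open>fps_exp c - 1\<close> has zero constant term. For natural \<open>c\<close> it describes
  choosing a nonempty subset and coloring it with \<open>c\<close> colors.\<close>

lemma egf_mult_exp_minus_one:
  fixes f :: "real fps"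
  shows "fact n * ((fps_exp c - 1) * f) $ n =
    (\<Sum>i=1..n. real (n choose i) * c ^ i * (fact (n - i) * f $ (n - i)))"
proof -
  have "((fps_exp c - 1) * f) $ n = (\<Sum>i=0..n. (fps_exp c - 1) $ i * f $ (n - i))"
    by (simp add: fps_mult_nth)
  also have "\<dots> = (\<Sum>i=1..n. (fps_exp c - 1) $ i * f $ (n - i))"
    by (rule sum.mono_neutral_right) (auto simp: not_le)
  finally have "fact n * ((fps_exp c - 1) * f) $ n =
    (\<Sum>i=1..n. fact n * ((fps_exp c - 1) $ i * f $ (n - i)))"
    by (simp add: sum_distrib_left)
  also have "\<dots> = (\<Sum>i=1..n. real (n choose i) * c ^ i * (fact (n - i) * f $ (n - i)))"
    by (rule sum.cong) (auto simp: binomial_fact field_simps)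
  finally show ?thesis .
qed

definition fish :: "nat \<Rightarrow> real fps" where
  "fish m = (\<Prod>i=1..m. 1 - fps_exp (- real i))"

lemma fish_0 [simp]: "fish 0 = 1"
  by (simp add: fish_def)

lemma fish_Suc: "fish (Suc m) = (1 - fps_exp (- real (Suc m))) * fish m"
  by (simp add: fish_def mult.commute)

lemma fps_mult_nth_eq_0:
  fixes f g :: "'a :: semiring_0 fps"
  assumes "\<And>i. i \<le> n \<Longrightarrow> g $ i = 0"
  shows "(f * g) $ n = 0"
  by (simp add: fps_mult_nth assms)

lemma fps_mult_nth_eq_0':
  fixes f g :: "'a :: semiring_0 fps"
  assumes "f $ 0 = 0" "\<And>i. i < n \<Longrightarrow> g $ i = 0"
  shows "(f * g) $ n = 0"
  unfolding fps_mult_nth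
proof (rule sum.neutral, safe)
  fix i assume "i \<in> {0..n}"
  show "f $ i * g $ (n - i) = 0"
    by (cases "i = 0") (use assms \<open>i \<in> {0..n}\<close> in auto)
qed

text \<open>Each of the \<open>m\<close> factors has zero constant term. This is why finite sums
  over \<open>m\<close> suffice below.\<close>

lemma fish_nth_eq_0: "n < m \<Longrightarrow> fish m $ n = 0"
proof (induction m arbitrary: n)
  case (Suc m)
  show ?case
    unfolding fish_Suc by (rule fps_mult_nth_eq_0') (use Suc in auto)
qed simp

text \<open>The series \<open>Z\<^sub>m(q)\<close>. The subtracted term accounts for assignments
  that never use the new left label.\<close>

fun rep_egf :: "nat \<Rightarrow> nat \<Rightarrow> real fps" where
  "rep_egf 0 q = 1"
| "rep_egf (Suc m) q =
     (fps_exp (real (Suc q)) - 1) * rep_egf m (Suc q) - (fps_exp (real q) - 1) * rep_egf m q"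

lemma rep_egf_nth_eq_0: "n < m \<Longrightarrow> rep_egf m q $ n = 0"
proof (induction m arbitrary: n q)
  case (Suc m)
  have "((fps_exp (real r) - 1) * rep_egf m r) $ n = 0" for r
    by (rule fps_mult_nth_eq_0') (use Suc in auto)
  then show ?case by (simp del: of_nat_Suc)
qed simp

lemma sum_rep_egf_step:
  defines "X \<equiv> \<lambda>K q. fps_exp (real q) * (\<Sum>m\<le>K. rep_egf m q)"
  shows "X K q = 1 + (1 - fps_exp (- real (Suc q))) * X K (Suc q) - rep_egf (Suc K) q"
proof -
  define Y where "Y q = (\<Sum>m\<le>K. rep_egf m q)" for q
  have "Y q + rep_egf (Suc K) q = (\<Sum>m\<le>Suc K. rep_egf m q)"
    by (simp add: Y_def)
  also have "\<dots> = 1 + (\<Sum>m\<le>K. rep_egf (Suc m) q)"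
    by (subst sum.atMost_Suc_shift) simp
  also have "\<dots> = 1 + (fps_exp (real (Suc q)) - 1) * Y (Suc q) - (fps_exp (real q) - 1) * Y q"
    by (simp add: Y_def sum_subtractf sum_distrib_left)
  \<comment> \<open>Moving \<open>(fps_exp (real q) - 1) * Y q\<close> to the left side produces the
    factor \<open>fps_exp (real q)\<close> of \<open>X\<close>.\<close>
  finally have 1: "fps_exp (real q) * Y q = 1 + (fps_exp (real (Suc q)) - 1) * Y (Suc q) - rep_egf (Suc K) q"
    by (simp add: algebra_simps)
  have "fps_exp (- real (Suc q)) * fps_exp (real (Suc q)) = 1"
    by (simp del: of_nat_Suc add: fps_exp_add_mult [symmetric])
  then have "(fps_exp (real (Suc q)) - 1) = (1 - fps_exp (- real (Suc q))) * fps_exp (real (Suc q))"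
    by (simp add: algebra_simps)
  with 1 show ?thesis by (simp add: X_def Y_def mult.assoc)
qed

text \<open>Unfolding the functional equation \<open>J\<close> times leaves the remainder
  \<open>fish J * X J\<close>, which has no coefficient at \<open>n\<close> once
  \<open>J > K\<close>.\<close>

lemma sum_rep_egf:
  assumes "n \<le> K"
  shows "(\<Sum>m\<le>K. rep_egf m 0 $ n) = (\<Sum>m\<le>K. fish m $ n)"
proof -
  define X where "X q = fps_exp (real q) * (\<Sum>m\<le>K. rep_egf m q)" for q
  have "X 0 $ n = (\<Sum>j<J. fish j $ n) + (fish J * X J) $ n" for J
  proof (induction J)
    case (Suc J)
    have "fish J * X J = fish J + fish (Suc J) * X (Suc J) - fish J * rep_egf (Suc K) J"
      unfolding X_def sum_rep_egf_step [of J K] fish_Suc by (simp add: algebra_simps)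
    moreover have "(fish J * rep_egf (Suc K) J) $ n = 0"
      by (rule fps_mult_nth_eq_0, rule rep_egf_nth_eq_0) (use assms in auto)
    ultimately show ?case using Suc by simp
  qed simp
  from this [of "Suc K"] have "X 0 $ n = (\<Sum>j\<le>K. fish j $ n) + (X (Suc K) * fish (Suc K)) $ n"
    by (simp add: lessThan_Suc_atMost mult.commute del: of_nat_Suc)
  also have "(X (Suc K) * fish (Suc K)) $ n = 0"
    by (rule fps_mult_nth_eq_0, rule fish_nth_eq_0) (use assms in auto)
  finally show ?thesis by (simp add: X_def fps_sum_nth)
qed

section \<open>The determinant sum\<close>

text \<open>The coefficient of \<open>q - 1 + m choose m\<close> in \<open>descent_sum n s p q\<close> below,
  with \<open>N = n - s\<close> and \<open>k = p - s\<close>.\<close>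

definition fish_tail :: "nat \<Rightarrow> nat \<Rightarrow> nat \<Rightarrow> real" where
  "fish_tail N k m = - (\<Sum>d=Suc k..N. real (N choose d) * (- real m) ^ (d - k) *
     (fact (N - d) * fish (m - 1) $ (N - d)))"

text \<open>The term \<open>d = Suc k\<close> is split off; all others share a factor
  \<open>- real m\<close>. The two parts will match the raising operator and the eigenvector
  operator.\<close>

lemma fish_tail_step:
  assumes "k < N"
  shows "fish_tail N k m = real m * (real (N choose Suc k) * (fact (N - Suc k) * fish (m - 1) $ (N - Suc k)))
    - real m * fish_tail N (Suc k) m"
proof -
  have "{Suc k..N} = insert (Suc k) {Suc (Suc k)..N}"
    using assms by auto
  moreover have "(\<Sum>d=Suc (Suc k)..N. real (N choose d) * (- real m) ^ (d - k) *
     (fact (N - d) * fish (m - 1) $ (N - d))) =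
     (\<Sum>d=Suc (Suc k)..N. (- real m) * (real (N choose d) * (- real m) ^ (d - Suc k) *
     (fact (N - d) * fish (m - 1) $ (N - d))))"
  proof (rule sum.cong)
    fix d assume "d \<in> {Suc (Suc k)..N}"
    then have "d - k = Suc (d - Suc k)" by auto
    then show "real (N choose d) * (- real m) ^ (d - k) * (fact (N - d) * fish (m - 1) $ (N - d)) =
      (- real m) * (real (N choose d) * (- real m) ^ (d - Suc k) *
     (fact (N - d) * fish (m - 1) $ (N - d)))" by simp
  qed simp
  ultimately show ?thesis
    by (simp add: fish_tail_def sum_distrib_left sum_negf algebra_simps)
qed

lemma fish_tail_0:
  assumes "N > 0"
  shows "fish_tail N 0 m = fact N * fish m $ N"
proof (cases m)
  \<comment> \<open>Here \<open>m - 1\<close> truncates to 0, harmlessly, since all powers of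
    \<open>- real m\<close> in the sum vanish.\<close>
  case 0
  then show ?thesis using assms by (simp add: fish_tail_def power_0_left)
next
  case (Suc l)
  have "fact N * fish m $ N = - (fact N * ((fps_exp (- real m) - 1) * fish l) $ N)"
    by (simp add: Suc fish_Suc algebra_simps del: of_nat_Suc)
  also have "\<dots> = fish_tail N 0 m"
    unfolding egf_mult_exp_minus_one fish_tail_def by (simp add: Suc)
  finally show ?thesis ..
qed

section \<open>The two operators on the binomial basis\<close>

lemma times_binomial_raise: "q * (q + m choose m) = Suc m * (q + m choose Suc m)"
  using binomial_absorb_comp [of "q + m" m] binomial_absorption [of m "q + m"]
  by (simp del: binomial_Suc_Suc)

text \<open>By Pascal's rule the difference is a binomial with lower index \<open>m - 1\<close>,
  which the raising identity takes back to index \<open>m\<close>.\<close>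

lemma times_binomial_difference:
  assumes "q > 0"
  shows "real q * (real (q - 1 + m choose m) - real (q + m choose m)) = - real m * real (q - 1 + m choose m)"
proof (cases m)
  case (Suc l)
  obtain r where r: "q = Suc r" using assms by (cases q) auto
  have "real q * real (q + l choose l) = real (Suc l) * real (q + l choose Suc l)"
    using times_binomial_raise [of q l] by (simp only: flip: of_nat_mult)
  then show ?thesis
    by (simp add: r Suc algebra_simps)
qed simp

section \<open>Hessenberg determinants and run weights\<close>

text \<open>The whole breakpoint list, ends included, is a parameter, so that the minors met in the
  expansion are again of this form.\<close>

definition bp_matrix :: "nat \<Rightarrow> nat list \<Rightarrow> int mat" where
  "bp_matrix n xs = mat (length xs - 1) (length xs - 1)
     (\<lambda>(i, j). binom (n - xs ! i) (int (xs ! Suc j) - int (xs ! i)))"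

lemma det_bp_matrix_pair: "a \<le> n \<Longrightarrow> det (bp_matrix n [a, n]) = 1"
  by (subst det_single) (auto simp: bp_matrix_def binom_def nat_diff_distrib')

lemma det_bp_matrix_rec:
  assumes sorted: "sorted_wrt (<) (a # b # ys)" and ys: "ys \<noteq> []"
  shows "det (bp_matrix n (a # b # ys)) =
    int (n - a choose (b - a)) * det (bp_matrix n (b # ys)) - det (bp_matrix n (a # ys))"
proof -
  define A where "A = bp_matrix n (a # b # ys)"
  define k where "k = length ys - 1"
  have len: "length ys = Suc k" using ys by (simp add: k_def)
  have A: "A \<in> carrier_mat (Suc (Suc k)) (Suc (Suc k))"
    by (auto simp: A_def bp_matrix_def len)
  \<comment> \<open>From row 2 on, the lower index \<open>b - ys ! i\<close> is negative.\<close>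
  have col0: "A $$ (Suc (Suc i), 0) = 0" if "i < k" for i
    using that sorted by (auto simp: A_def bp_matrix_def len binom_def)
  have "det A = (\<Sum>i<Suc (Suc k). A $$ (i, 0) * cofactor A i 0)"
    using A by (rule laplace_expansion_column) simp
  also have "\<dots> = A $$ (0, 0) * cofactor A 0 0 + A $$ (1, 0) * cofactor A 1 0"
    by (subst sum.lessThan_Suc_shift, subst sum.lessThan_Suc_shift) (simp add: col0)
  also have "A $$ (0, 0) = int (n - a choose (b - a))"
    using sorted by (auto simp: A_def bp_matrix_def len binom_def nat_diff_distrib')
  also have "A $$ (1, 0) = 1"
    by (simp add: A_def bp_matrix_def len binom_def)
  also have "mat_delete A 0 0 = bp_matrix n (b # ys)"
    unfolding mat_delete_def
    by (rule eq_matI) (auto simp: A_def bp_matrix_def len)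
  then have "cofactor A 0 0 = det (bp_matrix n (b # ys))"
    by (simp add: cofactor_def)
  \<comment> \<open>Row 1 and column 0 both belong to \<open>b\<close>, so this minor forgets
    \<open>b\<close>. Deleting row 0 instead forgets \<open>a\<close>, and \<open>b\<close> keeps
    its row.\<close>
  also have "mat_delete A 1 0 = bp_matrix n (a # ys)"
    unfolding mat_delete_def
    by (rule eq_matI) (auto simp: A_def bp_matrix_def len nth_Cons')
  then have "cofactor A 1 0 = - det (bp_matrix n (a # ys))"
    by (simp add: cofactor_def)
  finally show ?thesis by (simp add: A_def)
qed

fun bp_weight :: "nat \<Rightarrow> nat list \<Rightarrow> int" where
  "bp_weight q (a # b # ys) = int q ^ (b - a) * bp_weight (Suc q) (b # ys)"
| "bp_weight q _ = 1"

lemma bp_weight_eq_prod: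
  "bp_weight q xs = (\<Prod>r<length xs - 1. int (q + r) ^ (xs ! Suc r - xs ! r))"
proof (induction q xs rule: bp_weight.induct)
  case (1 q a b ys)
  then show ?case by (simp add: prod.lessThan_Suc_shift add.assoc add.left_commute del: prod.lessThan_Suc)
qed auto

lemma bp_weight_step:
  assumes "ys \<noteq> []" "p < hd ys"
  shows "bp_weight q (p # ys) = int q * bp_weight q (Suc p # ys)"
proof (cases ys)
  case (Cons b zs)
  then have "b - p = Suc (b - Suc p)" using assms by auto
  with Cons show ?thesis by simp
qed (use assms in auto)

text \<open>The positions up to \<open>p\<close> are already decided: \<open>s \<le> p\<close> is the last breakpoint
  that still has a row in the matrix, and \<open>q\<close> is the number of the current run.\<close>

definition descent_sum :: "nat \<Rightarrow> nat \<Rightarrow> nat \<Rightarrow> nat \<Rightarrow> int" where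
  "descent_sum n s p q = (\<Sum>S\<in>Pow {Suc p..n - 1}.
     det (bp_matrix n (s # sorted_list_of_set S @ [n])) *
     bp_weight q (p # sorted_list_of_set S @ [n]))"

lemma descent_sum_last:
  assumes "s < n" "Suc p = n"
  shows "descent_sum n s p q = int q"
proof -
  have "{Suc p..n - 1} = {}" using assms by auto
  then show ?thesis using assms by (auto simp: descent_sum_def det_bp_matrix_pair)
qed

lemma sorted_list_of_set_insert_less:
  assumes "finite S" "\<And>x. x \<in> S \<Longrightarrow> a < (x :: nat)"
  shows "sorted_list_of_set (insert a S) = a # sorted_list_of_set S"
proof -
  have "Min (insert a S) = a"
    using assms by (intro Min_eqI) (auto simp: less_imp_le)
  moreover have "insert a S - {a} = S" using assms by auto
  ultimately show ?thesis
    using assms(1) sorted_list_of_set_nonempty [of "insert a S"] by simp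
qed

text \<open>The membership of \<open>Suc p\<close> is decided, and the step to it always has weight
  \<open>q\<close>. If it is a breakpoint, the next run has number \<open>Suc q\<close>, and
  \<open>det_bp_matrix_rec\<close> either makes it the new \<open>s\<close> or, with a minus sign,
  deletes its row.\<close>

lemma descent_sum_step:
  assumes "s \<le> p" "Suc p < n"
  shows "descent_sum n s p q = int q * (descent_sum n s (Suc p) q - descent_sum n s (Suc p) (Suc q)
    + int (n - s choose (Suc p - s)) * descent_sum n (Suc p) (Suc p) (Suc q))"
proof -
  let ?L = "\<lambda>S. sorted_list_of_set S @ [n]" and ?B = "{Suc (Suc p)..n - 1}"
  let ?f = "\<lambda>S. det (bp_matrix n (s # ?L S)) * bp_weight q (p # ?L S)"
  have B: "finite S" "\<And>x. x \<in> S \<Longrightarrow> Suc p < x \<and> x < n" if "S \<in> Pow ?B" for S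
  proof -
    from that have S: "S \<subseteq> ?B" by simp
    then show "finite S" by (rule finite_subset) simp
    fix x assume "x \<in> S"
    with S have "x \<in> ?B" by blast
    then show "Suc p < x \<and> x < n" using assms by auto
  qed
  have "{Suc p..n - 1} = insert (Suc p) ?B" using assms by auto
  then have "descent_sum n s p q = sum ?f (Pow ?B \<union> insert (Suc p) ` Pow ?B)"
    by (simp add: descent_sum_def Pow_insert)
  also have "\<dots> = sum ?f (Pow ?B) + sum ?f (insert (Suc p) ` Pow ?B)"
    by (rule sum.union_disjoint) auto
  also have "sum ?f (Pow ?B) = int q * descent_sum n s (Suc p) q"
    unfolding descent_sum_def sum_distrib_left
  proof (rule sum.cong)
    fix S assume S: "S \<in> Pow ?B"
    have "p < hd (?L S)"
    proof (cases "sorted_list_of_set S")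
      case (Cons x xs)
      then have "x \<in> S" using B(1) [OF S] by (metis list.set_intros(1) set_sorted_list_of_set)
      then show ?thesis using Cons B(2) [OF S] by force
    qed (use assms in auto)
    then show "?f S = int q * (det (bp_matrix n (s # ?L S)) * bp_weight q (Suc p # ?L S))"
      by (subst bp_weight_step) auto
  qed simp
  also have "sum ?f (insert (Suc p) ` Pow ?B) = (\<Sum>S\<in>Pow ?B. ?f (insert (Suc p) S))"
  proof (subst sum.reindex)
    show "inj_on (insert (Suc p)) (Pow ?B)"
      by (rule inj_onI) (metis B(2) insert_ident less_irrefl)
  qed simp
  also have "\<dots> = (\<Sum>S\<in>Pow ?B. int q * (int (n - s choose (Suc p - s)) *
       (det (bp_matrix n (Suc p # ?L S)) * bp_weight (Suc q) (Suc p # ?L S))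
     - det (bp_matrix n (s # ?L S)) * bp_weight (Suc q) (Suc p # ?L S)))"
  proof (rule sum.cong)
    fix S assume S: "S \<in> Pow ?B"
    have L: "sorted_list_of_set (insert (Suc p) S) = Suc p # sorted_list_of_set S"
      using B [OF S] by (intro sorted_list_of_set_insert_less) auto
    have "sorted_wrt (<) (s # Suc p # ?L S)"
      using B [OF S] assms by (force simp: sorted_wrt_append)
    then have "det (bp_matrix n (s # Suc p # ?L S)) =
      int (n - s choose (Suc p - s)) * det (bp_matrix n (Suc p # ?L S)) - det (bp_matrix n (s # ?L S))"
      by (rule det_bp_matrix_rec) simp
    moreover have "bp_weight q (p # Suc p # ?L S) = int q * bp_weight (Suc q) (Suc p # ?L S)"
      by simp
    ultimately show "?f (insert (Suc p) S) = int q * (int (n - s choose (Suc p - s)) *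
       (det (bp_matrix n (Suc p # ?L S)) * bp_weight (Suc q) (Suc p # ?L S))
     - det (bp_matrix n (s # ?L S)) * bp_weight (Suc q) (Suc p # ?L S))"
      unfolding L by (simp only: append_Cons) (simp only: algebra_simps)
  qed simp
  finally show ?thesis
    by (simp add: descent_sum_def sum_subtractf sum_distrib_left algebra_simps)
qed

lemma descent_sum_closed:
  assumes "s \<le> p" "p < n" "n \<le> K" "q > 0"
  shows "real_of_int (descent_sum n s p q) =
    (\<Sum>m\<le>K. real (q - 1 + m choose m) * fish_tail (n - s) (p - s) m)"
proof -
  \<comment> \<open>The raising operator applied to a whole expansion: the index moves up by one, so
    \<open>fish (m - 1)\<close> appears.\<close>
  have lift: "real q * (\<Sum>m\<le>K. real (q + m choose m) * fish m $ N) =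
    (\<Sum>m\<le>K. real m * real (q - 1 + m choose m) * fish (m - 1) $ N)" if "N < K" "q > 0" for N q
  proof -
    obtain r where q: "q = Suc r" using \<open>q > 0\<close> by (cases q) auto
    obtain L where L: "K = Suc L" using \<open>N < K\<close> by (cases K) auto
    have "real q * real (q + m choose m) = real (Suc m) * real (q - 1 + Suc m choose Suc m)" for m
      using times_binomial_raise [of q m] by (simp only: q add_Suc_shift diff_Suc_1 flip: of_nat_mult)
    then have "real q * (\<Sum>m\<le>K. real (q + m choose m) * fish m $ N) =
       (\<Sum>m\<le>K. real (Suc m) * real (q - 1 + Suc m choose Suc m) * fish m $ N)"
      unfolding sum_distrib_left by (metis mult.assoc)
    \<comment> \<open>The top summand vanishes since \<open>N < K\<close>, so the shifted range is
      again \<open>{..K}\<close>.\<close>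
    also have "\<dots> = (\<Sum>m\<le>L. real (Suc m) * real (q - 1 + Suc m choose Suc m) * fish m $ N)"
      using fish_nth_eq_0 [OF \<open>N < K\<close>] by (simp add: L)
    also have "\<dots> = (\<Sum>m\<le>K. real m * real (q - 1 + m choose m) * fish (m - 1) $ N)"
      unfolding L by (subst sum.atMost_Suc_shift) simp
    finally show ?thesis .
  qed
  show ?thesis using assms
  proof (induction "n - p" arbitrary: s p q)
    case (Suc k)
    define N where "N = n - s"
    have N: "p - s < N" "N \<le> K" using Suc by (auto simp: N_def)
    let ?e = "\<lambda>q m. real (q - 1 + m choose m)"
    let ?C = "real (N choose Suc (p - s))" and ?fa = "fact (N - Suc (p - s)) :: real"
    have next_tail: "real q * ((\<Sum>m\<le>K. ?e q m * fish_tail N (Suc (p - s)) m)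
        - (\<Sum>m\<le>K. ?e (Suc q) m * fish_tail N (Suc (p - s)) m)) =
       - (\<Sum>m\<le>K. real m * ?e q m * fish_tail N (Suc (p - s)) m)"
    proof -
      have "real q * (?e q m - ?e (Suc q) m) = - real m * ?e q m" for m
        using times_binomial_difference [OF Suc.prems(4)] by simp
      then have "real q * ?e q m * t - real q * ?e (Suc q) m * t = - (real m * ?e q m * t)" for m t
        by (metis (no_types) left_diff_distrib mult_minus_left right_diff_distrib)
      then show ?thesis
        by (simp add: right_diff_distrib sum_distrib_left sum_negf mult.assoc flip: sum_subtractf)
    qed
    \<comment> \<open>\<open>fish_tail_step\<close> under the sum, with both parts translated back
      into operators on functions of \<open>q\<close>.\<close>
    have top: "(\<Sum>m\<le>K. ?e q m * fish_tail N (p - s) m) =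
      ?C * ?fa * (real q * (\<Sum>m\<le>K. real (q + m choose m) * fish m $ (N - Suc (p - s))))
      + real q * ((\<Sum>m\<le>K. ?e q m * fish_tail N (Suc (p - s)) m)
        - (\<Sum>m\<le>K. ?e (Suc q) m * fish_tail N (Suc (p - s)) m))"
      unfolding next_tail
      by (subst lift)
        (use N Suc.prems(4) in \<open>auto simp: fish_tail_step [OF N(1)] sum_distrib_left algebra_simps
           sum.distrib sum_subtractf\<close>)
    show ?case
    proof (cases "Suc p = n")
      \<comment> \<open>At the last position the next tail is an empty sum, and only
        \<open>m = 0\<close> has a nonzero constant coefficient, which leaves
        \<open>q\<close>.\<close>
      case True
      have "N - Suc (p - s) = 0" "Suc (p - s) = N" using True N Suc.prems by (auto simp: N_def)
      moreover have "fish_tail N N m = 0" for m by (simp add: fish_tail_def)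
      moreover have "(\<Sum>m\<le>K. real (q + m choose m) * fish m $ 0) = 1"
      proof -
        have "(\<Sum>m\<le>K. real (q + m choose m) * fish m $ 0) =
          (\<Sum>m\<in>{0}. real (q + m choose m) * fish m $ 0)"
          by (rule sum.mono_neutral_right) (auto simp: fish_nth_eq_0)
        then show ?thesis by simp
      qed
      ultimately show ?thesis
        using top descent_sum_last [of s n p q] True Suc.prems by (simp add: N_def)
    next
      case False
      then have p: "Suc p < n" using Suc.prems by auto
      have step: "descent_sum n s p q = int q * (descent_sum n s (Suc p) q - descent_sum n s (Suc p) (Suc q)
          + int (N choose Suc (p - s)) * descent_sum n (Suc p) (Suc p) (Suc q))"
        using descent_sum_step [OF Suc.prems(1) p] Suc.prems(1) by (simp add: N_def Suc_diff_le)
      have "real_of_int (descent_sum n s (Suc p) q) = (\<Sum>m\<le>K. ?e q m * fish_tail N (Suc (p - s)) m)"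
        using Suc.hyps(1) [of "Suc p" s q] Suc.hyps(2) Suc.prems p by (simp add: N_def Suc_diff_le)
      moreover have "real_of_int (descent_sum n s (Suc p) (Suc q)) =
          (\<Sum>m\<le>K. ?e (Suc q) m * fish_tail N (Suc (p - s)) m)"
        using Suc.hyps(1) [of "Suc p" s "Suc q"] Suc.hyps(2) Suc.prems p by (simp add: N_def Suc_diff_le)
      \<comment> \<open>Here \<open>s\<close> and \<open>p\<close> coincide, so the tail is a full
        coefficient by \<open>fish_tail_0\<close>.\<close>
      moreover have "real_of_int (descent_sum n (Suc p) (Suc p) (Suc q)) =
          ?fa * (\<Sum>m\<le>K. real (q + m choose m) * fish m $ (N - Suc (p - s)))"
      proof -
        have "n - Suc p = N - Suc (p - s)" using Suc.prems by (simp add: N_def)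
        then show ?thesis
          using Suc.hyps(1) [of "Suc p" "Suc p" "Suc q"] Suc.hyps(2) Suc.prems p
          by (simp add: fish_tail_0 sum_distrib_left algebra_simps)
      qed
      ultimately show ?thesis
        unfolding N_def [symmetric] top step by (simp add: algebra_simps)
    qed
  qed simp
qed

lemma descent_sum_eq_sum_fish:
  assumes "n > 0"
  shows "real_of_int (descent_sum n 0 0 1) = (\<Sum>m\<le>n. fact n * fish m $ n)"
  using descent_sum_closed [of 0 0 n n 1] assms by (simp add: fish_tail_0)

lemma rhs_eq_descent_sum:
  "(\<Sum>S\<in>Pow {1..n - 1}. det (binom_matrix n S) *
       (\<Prod>r=1..card S + 1. int r ^ (breakpoint n S r - breakpoint n S (r - 1)))) = descent_sum n 0 0 1"
  unfolding descent_sum_def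
proof (rule sum.cong)
  fix S assume "S \<in> Pow {Suc 0..n - 1}"
  let ?L = "0 # sorted_list_of_set S @ [n]"
  have "binom_matrix n S = bp_matrix n ?L"
    by (simp add: binom_matrix_def bp_matrix_def breakpoint_def)
  moreover have "(\<Prod>r=1..card S + 1. int r ^ (breakpoint n S r - breakpoint n S (r - 1))) = bp_weight 1 ?L"
    unfolding bp_weight_eq_prod
    by (rule prod.reindex_bij_witness [of _ Suc "\<lambda>r. r - 1"]) (auto simp: breakpoint_def)
  ultimately show "det (binom_matrix n S) *
       (\<Prod>r=1..card S + 1. int r ^ (breakpoint n S r - breakpoint n S (r - 1))) =
     det (bp_matrix n ?L) * bp_weight 1 ?L"
    by simp
qed simp

section \<open>Counting canonical representations\<close>

text \<open>
  A function in \<open>reps A Q i j M\<close> assigns an interval to every element of \<open>A\<close>.  The labels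
  in \<open>Q\<close> may be used freely as left endpoints, whereas those in \<open>{i<..M}\<close> must all occur.
\<close>

definition reps :: "'a set \<Rightarrow> nat set \<Rightarrow> nat \<Rightarrow> nat \<Rightarrow> nat \<Rightarrow> ('a \<Rightarrow> nat \<times> nat) set" where
  "reps A Q i j M = {f \<in> extensional A.
     (\<forall>x\<in>A. (fst (f x) \<in> Q \<or> i < fst (f x)) \<and> fst (f x) \<le> snd (f x) \<and> j < snd (f x) \<and> snd (f x) \<le> M) \<and>
     {i<..M} \<subseteq> (fst \<circ> f) ` A \<and> {j<..M} \<subseteq> (snd \<circ> f) ` A}"

lemma finite_reps: "finite A \<Longrightarrow> finite (reps A Q i j M)"
proof (rule finite_subset)
  show "reps A Q i j M \<subseteq> A \<rightarrow>\<^sub>E {..M} \<times> {..M}"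
  proof
    fix f assume "f \<in> reps A Q i j M"
    then have "f \<in> extensional A" "\<forall>x\<in>A. fst (f x) \<le> snd (f x) \<and> snd (f x) \<le> M"
      by (simp_all add: reps_def)
    then show "f \<in> A \<rightarrow>\<^sub>E {..M} \<times> {..M}"
      by (auto simp: PiE_iff mem_Times_iff intro: order_trans)
  qed
qed (auto intro: finite_PiE)

lemma card_reps_insert:
  assumes "finite A" "Q \<subseteq> {..j}" "j < M"
  shows "card (reps A (insert (Suc j) Q) (Suc j) j M) =
    card (reps A Q j j M) + card (reps A Q (Suc j) j M)"
proof -
  have "reps A (insert (Suc j) Q) (Suc j) j M = reps A Q j j M \<union> reps A Q (Suc j) j M" (is "?L = ?R1 \<union> ?R2")
  proof (intro equalityI subsetI)
    fix f assume f: "f \<in> ?L"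
    show "f \<in> ?R1 \<union> ?R2"
    proof (cases "Suc j \<in> (fst \<circ> f) ` A")
      case True
      have "{j<..M} \<subseteq> insert (Suc j) {Suc j<..M}" by auto
      with True f have "{j<..M} \<subseteq> (fst \<circ> f) ` A" unfolding reps_def by blast
      moreover have "fst (f x) \<in> Q \<or> j < fst (f x)" if "x \<in> A" for x
        using f that by (auto simp: reps_def)
      ultimately have "f \<in> ?R1" using f by (simp add: reps_def)
      then show ?thesis ..
    next
      case False
      then have "fst (f x) \<noteq> Suc j" if "x \<in> A" for x
        using that by force
      then have "f \<in> ?R2" using f by (simp add: reps_def)
      then show ?thesis ..
    qed
  next
    fix f assume "f \<in> ?R1 \<union> ?R2"
    then show "f \<in> ?L"
    proof
      assume f: "f \<in> ?R1"
      have "{Suc j<..M} \<subseteq> {j<..M}" by auto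
      then have "{Suc j<..M} \<subseteq> (fst \<circ> f) ` A" using f unfolding reps_def by blast
      moreover have "fst (f x) \<in> insert (Suc j) Q \<or> Suc j < fst (f x)" if "x \<in> A" for x
      proof -
        have "fst (f x) \<in> Q \<or> j < fst (f x)" using f that by (simp add: reps_def)
        then show ?thesis by auto
      qed
      ultimately show ?thesis using f by (simp add: reps_def)
    qed (simp add: reps_def)
  qed
  moreover have "?R1 \<inter> ?R2 = {}"
  proof -
    have "Suc j \<in> (fst \<circ> f) ` A" if "f \<in> ?R1" for f
      using that \<open>j < M\<close> by (auto simp: reps_def)
    moreover have "Suc j \<notin> (fst \<circ> f) ` A" if "f \<in> ?R2" for f
    proof -
      have "fst (f x) \<in> Q \<or> Suc j < fst (f x)" if "x \<in> A" for x
        using \<open>f \<in> ?R2\<close> that by (simp add: reps_def)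
      then have "fst (f x) \<noteq> Suc j" if "x \<in> A" for x
        using \<open>Q \<subseteq> {..j}\<close> that by force
      then show ?thesis by force
    qed
    ultimately show ?thesis by blast
  qed
  ultimately show ?thesis
    by (simp add: card_Un_disjoint finite_reps assms)
qed

text \<open>Intervals ending at \<open>Suc j\<close> choose their left ends freely in
  \<open>Q\<close> and cannot supply a required left label beyond \<open>Suc j\<close>. So the
  conditions on \<open>B\<close> and on \<open>A - B\<close> are independent.\<close>

lemma card_reps_fixed_first:
  assumes "finite A" "Q \<subseteq> {..Suc j}" "B \<subseteq> A" "B \<noteq> {}" "j < M"
  shows "card {f \<in> reps A Q (Suc j) j M. {x \<in> A. snd (f x) = Suc j} = B} =
    card Q ^ card B * card (reps (A - B) Q (Suc j) (Suc j) M)"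
proof -
  let ?V = "{f \<in> reps A Q (Suc j) j M. {x \<in> A. snd (f x) = Suc j} = B}"
  let ?P = "(B \<rightarrow>\<^sub>E Q \<times> {Suc j}) \<times> reps (A - B) Q (Suc j) (Suc j) M"
  have "bij_betw (\<lambda>f. (restrict f B, restrict f (A - B))) ?V ?P"
  proof (rule bij_betwI [where g = "\<lambda>(g, h) x. if x \<in> B then g x else h x"])
    show "(\<lambda>f. (restrict f B, restrict f (A - B))) \<in> ?V \<rightarrow> ?P"
    proof
      fix f assume f: "f \<in> ?V"
      have B: "snd (f x) = Suc j" "fst (f x) \<in> Q" if "x \<in> B" for x
        using f that by (auto simp: reps_def)
      have C: "Suc j < snd (f x)" if "x \<in> A - B" for x
      proof -
        have "j < snd (f x)" "snd (f x) \<noteq> Suc j" using f that by (auto simp: reps_def)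
        then show ?thesis by simp
      qed
      have "restrict f B \<in> B \<rightarrow>\<^sub>E Q \<times> {Suc j}"
        using B by (auto simp: mem_Times_iff)
      moreover have "v \<in> (fst \<circ> restrict f (A - B)) ` (A - B)" if "v \<in> {Suc j<..M}" for v
      proof -
        have "v \<in> (fst \<circ> f) ` A" using f that by (auto simp: reps_def)
        then obtain x where x: "x \<in> A" "v = fst (f x)" by auto
        have "fst (f x) \<le> snd (f x)" using f x by (auto simp: reps_def)
        then have "x \<in> A - B" using x that B by force
        with x show ?thesis by force
      qed
      moreover have "v \<in> (snd \<circ> restrict f (A - B)) ` (A - B)" if "v \<in> {Suc j<..M}" for v
      proof -
        have "v \<in> (snd \<circ> f) ` A" using f that by (auto simp: reps_def)
        then obtain x where x: "x \<in> A" "v = snd (f x)" by auto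
        then have "x \<in> A - B" using x that B by force
        with x show ?thesis by force
      qed
      ultimately show "(restrict f B, restrict f (A - B)) \<in> ?P"
        using f C by (auto simp: reps_def)
    qed
    show "(\<lambda>(g, h) x. if x \<in> B then g x else h x) \<in> ?P \<rightarrow> ?V"
    proof (safe, goal_cases)
      case (1 g h)
      let ?f = "\<lambda>x. if x \<in> B then g x else h x"
      have g: "fst (g x) \<in> Q" "snd (g x) = Suc j" if "x \<in> B" for x
        using 1(1) that by (auto simp: PiE_iff mem_Times_iff)
      have "v \<in> (fst \<circ> ?f) ` A" if "v \<in> {Suc j<..M}" for v
      proof -
        have "v \<in> (fst \<circ> h) ` (A - B)" using 1(2) that by (auto simp: reps_def)
        then show ?thesis by force
      qed
      moreover have "v \<in> (snd \<circ> ?f) ` A" if "v \<in> {j<..M}" for v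
      proof (cases "v = Suc j")
        case True
        \<comment> \<open>The right label \<open>Suc j\<close> is attained because \<open>B\<close>
          is nonempty.\<close>
        then show ?thesis using g assms by force
      next
        case False
        then have "v \<in> {Suc j<..M}" using that by auto
        then have "v \<in> (snd \<circ> h) ` (A - B)" using 1(2) by (auto simp: reps_def)
        then show ?thesis by force
      qed
      moreover have "?f \<in> extensional A"
        using 1 assms by (auto simp: reps_def extensional_def)
      moreover have "(fst (?f x) \<in> Q \<or> Suc j < fst (?f x)) \<and> fst (?f x) \<le> snd (?f x) \<and> j < snd (?f x) \<and> snd (?f x) \<le> M"
        if "x \<in> A" for x
      proof (cases "x \<in> B")
        case True
        then show ?thesis using g [of x] assms by auto
      next
        case False
        then have "(fst (h x) \<in> Q \<or> Suc j < fst (h x)) \<and> fst (h x) \<le> snd (h x) \<and> Suc j < snd (h x) \<and> snd (h x) \<le> M"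
          using 1(2) that by (simp add: reps_def)
        then show ?thesis using False by simp
      qed
      ultimately show ?case unfolding reps_def by blast
    next
      case (2 g h x)
      have "\<forall>x\<in>A - B. Suc j < snd (h x)"
        using 2(2) by (simp add: reps_def)
      with 2(3) have "Suc j < snd (h x)" if "x \<notin> B"
        using that by blast
      with 2(4) show ?case by (auto split: if_splits)
    next
      case (3 g h x)
      then show ?case using assms by auto
    next
      case (4 g h x)
      then show ?case by (auto simp: PiE_iff mem_Times_iff)
    qed
  qed (use assms in \<open>auto simp: reps_def fun_eq_iff extensional_def PiE_iff restrict_def\<close>)
  then have "card ?V = card ?P" by (rule bij_betw_same_card)
  also have "finite B" using assms finite_subset by auto
  then have "card ?P = card Q ^ card B * card (reps (A - B) Q (Suc j) (Suc j) M)"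
    by (simp add: card_cartesian_product card_PiE)
  finally show ?thesis .
qed

lemma card_reps_remove_first:
  assumes "finite A" "Q \<subseteq> {..Suc j}" "j < M"
  shows "card (reps A Q (Suc j) j M) =
    (\<Sum>B\<in>Pow A - {{}}. card Q ^ card B * card (reps (A - B) Q (Suc j) (Suc j) M))"
proof -
  let ?V = "reps A Q (Suc j) j M" and ?B = "\<lambda>f. {x \<in> A. snd (f x) = Suc j}"
  have "?B f \<noteq> {}" if "f \<in> ?V" for f
  proof -
    have "Suc j \<in> (snd \<circ> f) ` A" using that assms by (auto simp: reps_def)
    then show ?thesis by force
  qed
  then have "?B ` ?V \<subseteq> Pow A - {{}}" by auto
  then have "card ?V = (\<Sum>B\<in>Pow A - {{}}. card {f \<in> ?V. ?B f = B})"
    using sum.group [of ?V "Pow A - {{}}" ?B "\<lambda>_. 1 :: nat"] assms by (simp add: finite_reps)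
  also have "\<dots> = (\<Sum>B\<in>Pow A - {{}}. card Q ^ card B * card (reps (A - B) Q (Suc j) (Suc j) M))"
    by (rule sum.cong) (use card_reps_fixed_first [OF assms(1,2) _ _ assms(3)] in auto)
  finally show ?thesis .
qed

lemma sum_Pow_card:
  fixes g :: "nat \<Rightarrow> 'b :: semiring_1"
  assumes "finite A"
  shows "(\<Sum>B\<in>Pow A - {{}}. g (card B)) = (\<Sum>i=1..card A. of_nat (card A choose i) * g i)"
proof -
  have "card ` (Pow A - {{}}) \<subseteq> {1..card A}"
  proof (rule image_subsetI)
    fix B assume "B \<in> Pow A - {{}}"
    then show "card B \<in> {1..card A}"
      using assms card_mono [of A B] finite_subset [of B A] by (auto simp: Suc_le_eq card_gt_0_iff)
  qed
  then have "(\<Sum>B\<in>Pow A - {{}}. g (card B)) =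
     (\<Sum>i=1..card A. \<Sum>B\<in>{B \<in> Pow A - {{}}. card B = i}. g (card B))"
    using assms by (intro sum.group [symmetric]) auto
  also have "\<dots> = (\<Sum>i=1..card A. of_nat (card A choose i) * g i)"
  proof (rule sum.cong)
    fix i assume "i \<in> {1..card A}"
    then have "{B \<in> Pow A - {{}}. card B = i} = {B. B \<subseteq> A \<and> card B = i}" by auto
    then show "(\<Sum>B\<in>{B \<in> Pow A - {{}}. card B = i}. g (card B)) = of_nat (card A choose i) * g i"
      using assms by (simp add: n_subsets)
  qed simp
  finally show ?thesis .
qed

text \<open>Induction on the number \<open>m\<close> of labels still required; of the free labels
  only their number matters.\<close>

lemma card_reps:
  assumes "finite A" "finite Q" "Q \<subseteq> {..j}"
  shows "real (card (reps A Q j j (j + m))) = fact (card A) * rep_egf m (card Q) $ card A"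
  using assms
proof (induction m arbitrary: A Q j)
  case 0
  show ?case
  proof (cases "A = {}")
    case True
    then have "reps A Q j j (j + 0) = {\<lambda>x. undefined}" by (auto simp: reps_def)
    then show ?thesis by (simp add: True)
  next
    case False
    then have "reps A Q j j (j + 0) = {}" by (force simp: reps_def)
    then show ?thesis using 0 False by simp
  qed
next
  case (Suc m)
  \<comment> \<open>Summing over the block of intervals that end first gives a binomial convolution.
    It is used both with and without the new label \<open>Suc j\<close>, and
    \<open>card_reps_insert\<close> yields the difference.\<close>
  have V: "real (card (reps A R (Suc j) j (j + Suc m))) =
     fact (card A) * ((fps_exp (real (card R)) - 1) * rep_egf m (card R)) $ card A"
    if R: "finite R" "R \<subseteq> {..Suc j}" for R
  proof -
    have "real (card (reps A R (Suc j) j (j + Suc m))) =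
      (\<Sum>B\<in>Pow A - {{}}. real (card R) ^ card B * real (card (reps (A - B) R (Suc j) (Suc j) (Suc j + m))))"
      using card_reps_remove_first [of A R j "j + Suc m"] R Suc.prems by simp
    also have "\<dots> = (\<Sum>B\<in>Pow A - {{}}. (\<lambda>b. real (card R) ^ b *
        (fact (card A - b) * rep_egf m (card R) $ (card A - b))) (card B))"
    proof (rule sum.cong)
      fix B assume "B \<in> Pow A - {{}}"
      then have "card (A - B) = card A - card B"
        using Suc.prems(1) by (auto intro: card_Diff_subset finite_subset)
      then show "real (card R) ^ card B * real (card (reps (A - B) R (Suc j) (Suc j) (Suc j + m))) =
        (\<lambda>b. real (card R) ^ b * (fact (card A - b) * rep_egf m (card R) $ (card A - b))) (card B)"
        using Suc.IH [of "A - B" R "Suc j"] R Suc.prems by simp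
    qed simp
    also have "\<dots> = fact (card A) * ((fps_exp (real (card R)) - 1) * rep_egf m (card R)) $ card A"
      by (subst sum_Pow_card) (use Suc.prems in \<open>simp_all add: egf_mult_exp_minus_one mult.assoc\<close>)
    finally show ?thesis .
  qed
  have "Suc j \<notin> Q" using Suc.prems by auto
  then have "card (insert (Suc j) Q) = Suc (card Q)" using Suc.prems by simp
  moreover have "insert (Suc j) Q \<subseteq> {..Suc j}" "Q \<subseteq> {..Suc j}" using Suc.prems by auto
  ultimately show ?case
    using card_reps_insert [of A Q j "j + Suc m"] V [of Q] V [of "insert (Suc j) Q"] Suc.prems
    by (simp add: algebra_simps del: of_nat_Suc)
qed

section \<open>Interval orders and their canonical representations\<close>

definition order_of_rep :: "'a set \<Rightarrow> ('a \<Rightarrow> nat \<times> nat) \<Rightarrow> 'a rel" where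
  "order_of_rep A f = {(x, y) \<in> A \<times> A. x = y \<or> snd (f x) < fst (f y)}"

lemma interval_order_on_order_of_rep:
  assumes le: "\<And>x. x \<in> A \<Longrightarrow> fst (f x) \<le> snd (f x)"
  shows "interval_order_on A (order_of_rep A f)"
  unfolding interval_order_on_def
proof (rule conjI)
  have "trans (order_of_rep A f)"
  proof (rule transI)
    fix x y z assume xyz: "(x, y) \<in> order_of_rep A f" "(y, z) \<in> order_of_rep A f"
    then show "(x, z) \<in> order_of_rep A f"
      using le [of y] by (auto simp: order_of_rep_def)
  qed
  moreover have "antisym (order_of_rep A f)"
  proof (rule antisymI)
    fix x y assume "(x, y) \<in> order_of_rep A f" "(y, x) \<in> order_of_rep A f"
    then show "x = y"
      using le [of x] le [of y] by (auto simp: order_of_rep_def)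
  qed
  ultimately show "partial_order_on A (order_of_rep A f)"
    by (auto simp: partial_order_on_def preorder_on_def refl_on_def order_of_rep_def)
  have "(x, y) \<in> order_of_rep A f \<and> x \<noteq> y \<longleftrightarrow> snd (f x) < fst (f y)" if "x \<in> A" "y \<in> A" for x y
    using that le [of y] by (auto simp: order_of_rep_def)
  then show "\<exists>lo hi :: 'a \<Rightarrow> real. (\<forall>z\<in>A. lo z \<le> hi z) \<and>
      (\<forall>x\<in>A. \<forall>y\<in>A. ((x, y) \<in> order_of_rep A f \<and> x \<noteq> y) = (hi x < lo y))"
    using le
    by (intro exI [of _ "\<lambda>x. real (fst (f x))"] exI [of _ "\<lambda>x. real (snd (f x))"]) simp
qed

section \<open>Recovering a representation from its order\<close>

text \<open>The sets \<open>E z\<close> form a chain indexed by \<open>{0<..m}\<close> through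
  \<open>F\<close>, so \<open>g x\<close> is the rank of \<open>E x\<close> in it.\<close>

lemma card_lower_sets:
  fixes g :: "'a \<Rightarrow> nat" and F :: "nat \<Rightarrow> 'b set"
  assumes g: "g ` A = {0<..m}" and x: "x \<in> A"
    and E: "\<And>z. z \<in> A \<Longrightarrow> E z = F (g z)"
    and F: "\<And>v w. v \<in> {0<..m} \<Longrightarrow> w \<in> {0<..m} \<Longrightarrow> F v \<subseteq> F w \<longleftrightarrow> v \<le> w"
  shows "card {E z | z. z \<in> A \<and> E z \<subseteq> E x} = g x"
proof -
  have gx: "g z \<in> {0<..m}" if "z \<in> A" for z using g that by blast
  have E_le: "E z \<subseteq> E x \<longleftrightarrow> g z \<le> g x" if "z \<in> A" for z
    unfolding E [OF that] E [OF x] by (rule F [OF gx [OF that] gx [OF x]])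
  have "{E z | z. z \<in> A \<and> E z \<subseteq> E x} = F ` {0<..g x}"
  proof (intro equalityI subsetI)
    fix D assume "D \<in> {E z | z. z \<in> A \<and> E z \<subseteq> E x}"
    then obtain z where z: "z \<in> A" "D = E z" "E z \<subseteq> E x" by blast
    then have "g z \<in> {0<..g x}" using E_le gx by simp
    then show "D \<in> F ` {0<..g x}" using z(2) E [OF z(1)] by simp
  next
    fix D assume "D \<in> F ` {0<..g x}"
    then obtain v where v: "D = F v" "0 < v" "v \<le> g x" by auto
    with gx [OF x] have "v \<in> g ` A" unfolding g by simp
    then obtain z where z: "z \<in> A" "v = g z" by blast
    then have "E z \<subseteq> E x" "D = E z" using v E_le E by simp_all
    with z show "D \<in> {E z | z. z \<in> A \<and> E z \<subseteq> E x}" by blast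
  qed
  moreover have "inj_on F {0<..g x}"
  proof (rule inj_onI)
    fix v w assume "v \<in> {0<..g x}" "w \<in> {0<..g x}" "F v = F w"
    with F [of v w] F [of w v] gx [OF x] show "v = w" by simp
  qed
  ultimately show ?thesis by (simp add: card_image)
qed

lemma reps_images:
  assumes "f \<in> reps A {} 0 0 m"
  shows "(fst \<circ> f) ` A = {0<..m}" "(snd \<circ> f) ` A = {0<..m}"
proof -
  have "(fst \<circ> f) x \<in> {0<..m}" "(snd \<circ> f) x \<in> {0<..m}" if "x \<in> A" for x
  proof -
    have "0 < fst (f x)" "fst (f x) \<le> snd (f x)" "snd (f x) \<le> m"
      using assms that by (simp_all add: reps_def)
    then show "(fst \<circ> f) x \<in> {0<..m}" "(snd \<circ> f) x \<in> {0<..m}" by simp_all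
  qed
  then have "(fst \<circ> f) ` A \<subseteq> {0<..m}" "(snd \<circ> f) ` A \<subseteq> {0<..m}"
    by (simp_all only: image_subsetI)
  moreover have "{0<..m} \<subseteq> (fst \<circ> f) ` A" "{0<..m} \<subseteq> (snd \<circ> f) ` A"
    using assms by (simp_all add: reps_def)
  ultimately show "(fst \<circ> f) ` A = {0<..m}" "(snd \<circ> f) ` A = {0<..m}"
    by (simp_all only: subset_antisym)
qed

text \<open>The left endpoint of \<open>x\<close> is the rank of its strict down-set, the right endpoint
  the rank of the complement of its strict up-set.\<close>

lemma rep_from_order:
  assumes f: "f \<in> reps A {} 0 0 m" and x: "x \<in> A"
  defines "P \<equiv> order_of_rep A f"
  defines "D \<equiv> \<lambda>z. {y \<in> A. (y, z) \<in> P \<and> y \<noteq> z}"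
    and "U \<equiv> \<lambda>z. {y \<in> A. (z, y) \<in> P \<longrightarrow> z = y}"
  shows "f x = (card {D z | z. z \<in> A \<and> D z \<subseteq> D x}, card {U z | z. z \<in> A \<and> U z \<subseteq> U x})"
proof (rule prod_eqI)
  note im = reps_images [OF f]
  have le: "fst (f z) \<le> snd (f z)" if "z \<in> A" for z
    using f that by (simp add: reps_def)
  let ?F = "\<lambda>v. {y \<in> A. snd (f y) < v}" and ?G = "\<lambda>v. {y \<in> A. fst (f y) \<le> v}"
  have D: "D z = ?F ((fst \<circ> f) z)" if "z \<in> A" for z
  proof (rule Set.set_eqI)
    fix y show "y \<in> D z \<longleftrightarrow> y \<in> ?F ((fst \<circ> f) z)"
      using le [OF that] that by (cases "y = z") (simp_all add: D_def P_def order_of_rep_def)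
  qed
  have U: "U z = ?G ((snd \<circ> f) z)" if "z \<in> A" for z
  proof (rule Set.set_eqI)
    fix y show "y \<in> U z \<longleftrightarrow> y \<in> ?G ((snd \<circ> f) z)"
      using le [OF that] that
      by (cases "y = z") (auto simp: U_def P_def order_of_rep_def)
  qed
  \<comment> \<open>An interval ending exactly at \<open>w\<close> separates \<open>?F w\<close>
    from all later sets. So left ends are recovered because every point is a right end, and dually
    for \<open>?G\<close>.\<close>
  have F: "?F v \<subseteq> ?F w \<longleftrightarrow> v \<le> w" if "w \<in> {0<..m}" for v w
  proof
    assume *: "?F v \<subseteq> ?F w"
    have "w \<in> (snd \<circ> f) ` A" using that unfolding im(2) .
    then obtain y where "y \<in> A" "w = snd (f y)" by (auto simp only: comp_apply)
    with * have "\<not> w < v" by blast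
    then show "v \<le> w" by simp
  next
    assume "v \<le> w"
    then show "?F v \<subseteq> ?F w" by (intro Collect_mono) simp
  qed
  have G: "?G v \<subseteq> ?G w \<longleftrightarrow> v \<le> w" if "v \<in> {0<..m}" for v w
  proof
    assume *: "?G v \<subseteq> ?G w"
    have "v \<in> (fst \<circ> f) ` A" using that unfolding im(1) .
    then obtain y where "y \<in> A" "v = fst (f y)" by (auto simp only: comp_apply)
    with * show "v \<le> w" by blast
  next
    assume "v \<le> w"
    then show "?G v \<subseteq> ?G w" by (intro Collect_mono) simp
  qed
  show "fst (f x) = fst (card {D z | z. z \<in> A \<and> D z \<subseteq> D x}, card {U z | z. z \<in> A \<and> U z \<subseteq> U x})"
    using card_lower_sets [OF im(1) x D F] by (simp only: fst_conv comp_apply)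
  show "snd (f x) = snd (card {D z | z. z \<in> A \<and> D z \<subseteq> D x}, card {U z | z. z \<in> A \<and> U z \<subseteq> U x})"
    using card_lower_sets [OF im(2) x U G] by (simp only: snd_conv comp_apply)
qed

text \<open>The formula of \<open>rep_from_order\<close> mentions neither \<open>m\<close> nor
  \<open>f\<close> except through the order, so different lengths are covered too.\<close>

lemma order_of_rep_inj:
  assumes f: "f \<in> reps A {} 0 0 m" and g: "g \<in> reps A {} 0 0 m'"
    and eq: "order_of_rep A f = order_of_rep A g"
  shows "f = g"
proof (rule extensionalityI)
  show "f \<in> extensional A" "g \<in> extensional A" using f g by (auto simp: reps_def)
  show "f x = g x" if "x \<in> A" for x
    unfolding rep_from_order [OF f that] rep_from_order [OF g that] eq ..
qed

section \<open>Existence of canonical representations\<close>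

text \<open>Points may be skipped here, unlike in \<open>reps\<close>, so that \<open>m\<close> can
  be minimized.\<close>

definition weak_rep :: "'a set \<Rightarrow> 'a rel \<Rightarrow> nat \<Rightarrow> ('a \<Rightarrow> nat \<times> nat) \<Rightarrow> bool" where
  "weak_rep A P m f \<longleftrightarrow>
     (\<forall>x\<in>A. 0 < fst (f x) \<and> fst (f x) \<le> snd (f x) \<and> snd (f x) \<le> m) \<and> order_of_rep A f = P"

text \<open>Each real endpoint is replaced by its rank among all endpoints, which preserves every
  comparison between them.\<close>

lemma weak_rep_exists:
  assumes "finite A" "interval_order_on A P"
  shows "\<exists>m f. weak_rep A P m f"
proof -
  from assms obtain lo hi :: "'a \<Rightarrow> real" where
    le: "\<And>z. z \<in> A \<Longrightarrow> lo z \<le> hi z" and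
    lt: "\<And>x y. x \<in> A \<Longrightarrow> y \<in> A \<Longrightarrow> (x, y) \<in> P \<and> x \<noteq> y \<longleftrightarrow> hi x < lo y" and
    P: "partial_order_on A P"
    unfolding interval_order_on_def by blast
  define E where "E = lo ` A \<union> hi ` A"
  define rk where "rk t = card {e \<in> E. e \<le> t}" for t
  have "finite E" using assms by (simp add: E_def)
  have mono: "rk s \<le> rk t" if "s \<le> t" for s t
    unfolding rk_def using \<open>finite E\<close> that by (intro card_mono) auto
  have strict: "rk s < rk t" if "s < t" "t \<in> E" for s t
    unfolding rk_def
  proof (rule psubset_card_mono)
    have "t \<in> {e \<in> E. e \<le> t}" "t \<notin> {e \<in> E. e \<le> s}" using that by simp_all
    moreover have "{e \<in> E. e \<le> s} \<subseteq> {e \<in> E. e \<le> t}" using that by auto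
    ultimately show "{e \<in> E. e \<le> s} \<subset> {e \<in> E. e \<le> t}" by blast
  qed (use \<open>finite E\<close> in auto)
  have iff: "rk s < rk t \<longleftrightarrow> s < t" if "t \<in> E" for s t
    using mono [of t s] strict [of s t] that by (meson linorder_not_le)
  have E: "lo x \<in> E" "hi x \<in> E" if "x \<in> A" for x using that by (auto simp: E_def)
  have "0 < rk t" "rk t \<le> card E" if "t \<in> E" for t
    unfolding rk_def using \<open>finite E\<close> that by (auto simp: card_gt_0_iff intro: card_mono)
  moreover have "order_of_rep A (\<lambda>x. (rk (lo x), rk (hi x))) = P"
  proof (intro Set.set_eqI iffI)
    fix p assume "p \<in> order_of_rep A (\<lambda>x. (rk (lo x), rk (hi x)))"
    moreover obtain x y where "p = (x, y)" by (cases p)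
    ultimately show "p \<in> P"
      using lt [of x y] partial_order_onD(1) [OF P]
      by (auto simp: order_of_rep_def refl_on_def iff E)
  next
    fix p assume "p \<in> P"
    moreover obtain x y where "p = (x, y)" by (cases p)
    ultimately show "p \<in> order_of_rep A (\<lambda>x. (rk (lo x), rk (hi x)))"
      using lt [of x y] partial_order_onD(4) [OF P] by (auto simp: order_of_rep_def iff E)
  qed
  ultimately have "weak_rep A P (card E) (\<lambda>x. (rk (lo x), rk (hi x)))"
    using E mono le by (simp add: weak_rep_def)
  then show ?thesis by blast
qed

text \<open>If no interval starts at \<open>v\<close>, or none ends there, the points \<open>v - 1\<close> and \<open>v\<close>
  (respectively \<open>v\<close> and \<open>v + 1\<close>) can be merged.\<close>

lemma weak_rep_shrink_left:
  assumes f: "weak_rep A P m f" and v: "v \<in> {0<..m}" "v \<notin> (fst \<circ> f) ` A"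
  shows "\<exists>g. weak_rep A P (m - 1) g"
proof -
  define s where "s t = (if v \<le> t then t - 1 else t)" for t
  define g where "g x = (s (fst (f x)), s (snd (f x)))" for x
  have ne: "fst (f x) \<noteq> v" if "x \<in> A" for x using v(2) that by force
  have f': "0 < fst (f x)" "fst (f x) \<le> snd (f x)" "snd (f x) \<le> m" if "x \<in> A" for x
    using f that by (auto simp: weak_rep_def)
  have "0 < fst (g x) \<and> fst (g x) \<le> snd (g x) \<and> snd (g x) \<le> m - 1" if "x \<in> A" for x
    using f' [OF that] ne [OF that] v(1) by (auto simp: g_def s_def)
  \<comment> \<open>Merging could only destroy a comparison of right end \<open>v - 1\<close> with
    left end \<open>v\<close>, and no interval starts at \<open>v\<close>.\<close>
  moreover have "snd (g x) < fst (g y) \<longleftrightarrow> snd (f x) < fst (f y)" if "y \<in> A" for x y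
    using f' [OF that] ne [OF that] v(1) by (auto simp: g_def s_def)
  then have "order_of_rep A g = order_of_rep A f"
    by (auto simp: order_of_rep_def)
  ultimately show ?thesis using f by (auto simp: weak_rep_def)
qed

lemma weak_rep_shrink_right:
  assumes f: "weak_rep A P m f" and v: "v \<in> {0<..m}" "v \<notin> (snd \<circ> f) ` A"
  shows "\<exists>g. weak_rep A P (m - 1) g"
proof -
  define s where "s t = (if v < t then t - 1 else t)" for t
  define g where "g x = (s (fst (f x)), s (snd (f x)))" for x
  have ne: "snd (f x) \<noteq> v" if "x \<in> A" for x using v(2) that by force
  have f': "0 < fst (f x)" "fst (f x) \<le> snd (f x)" "snd (f x) \<le> m" if "x \<in> A" for x
    using f that by (auto simp: weak_rep_def)
  have "0 < fst (g x) \<and> fst (g x) \<le> snd (g x) \<and> snd (g x) \<le> m - 1" if "x \<in> A" for x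
    using f' [OF that] ne [OF that] v(1) by (auto simp: g_def s_def)
  \<comment> \<open>Here the only comparison at risk is right end \<open>v\<close> against left end
    \<open>v + 1\<close>.\<close>
  moreover have "snd (g x) < fst (g y) \<longleftrightarrow> snd (f x) < fst (f y)" if "x \<in> A" for x y
    using f' [OF that] ne [OF that] v(1) by (auto simp: g_def s_def)
  then have "order_of_rep A g = order_of_rep A f"
    by (auto simp: order_of_rep_def)
  ultimately show ?thesis using f by (auto simp: weak_rep_def)
qed

text \<open>In a weak representation of least length no point can be merged away, so every point is
  both a left and a right end. The left ends then bound \<open>m\<close> by
  \<open>card A\<close>.\<close>

lemma reps_exists:
  assumes "finite A" "interval_order_on A P"
  obtains m f where "m \<le> card A" "f \<in> reps A {} 0 0 m" "order_of_rep A f = P"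
proof -
  define m where "m = (LEAST m. \<exists>f. weak_rep A P m f)"
  obtain f where f: "weak_rep A P m f"
    using LeastI_ex [OF weak_rep_exists [OF assms]] unfolding m_def by blast
  have min: "\<not> weak_rep A P (m - 1) g" if "0 < m" for g
    using not_less_Least [of "m - 1" "\<lambda>m. \<exists>f. weak_rep A P m f"] that unfolding m_def by auto
  have l: "{0<..m} \<subseteq> (fst \<circ> f) ` A"
    using weak_rep_shrink_left [OF f] min by force
  have r: "{0<..m} \<subseteq> (snd \<circ> f) ` A"
    using weak_rep_shrink_right [OF f] min by force
  have "restrict f A \<in> reps A {} 0 0 m"
    using f l r by (force simp: reps_def weak_rep_def image_iff subset_iff)
  moreover have "order_of_rep A (restrict f A) = P"
    using f by (auto simp: order_of_rep_def weak_rep_def)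
  moreover have "m \<le> card A"
    using surj_card_le [OF assms(1) l] by simp
  ultimately show ?thesis using that by blast
qed

lemma card_interval_orders:
  assumes "finite A"
  shows "card {P. interval_order_on A P} = (\<Sum>m\<le>card A. card (reps A {} 0 0 m))"
proof -
  let ?R = "\<Union>m\<le>card A. reps A {} 0 0 m"
  have "{P. interval_order_on A P} = order_of_rep A ` ?R"
  proof (intro equalityI subsetI)
    fix P assume "P \<in> {P. interval_order_on A P}"
    then show "P \<in> order_of_rep A ` ?R"
      using reps_exists [OF assms] by (metis (no_types, lifting) UN_I atMost_iff image_eqI mem_Collect_eq)
  next
    fix P assume "P \<in> order_of_rep A ` ?R"
    then show "P \<in> {P. interval_order_on A P}"
      by (auto simp: reps_def intro!: interval_order_on_order_of_rep)
  qed
  moreover have "inj_on (order_of_rep A) ?R"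
    by (rule inj_onI) (use order_of_rep_inj in blast)
  moreover have "card ?R = (\<Sum>m\<le>card A. card (reps A {} 0 0 m))"
  proof (rule card_UN_disjoint)
    show "\<forall>m\<in>{..card A}. \<forall>m'\<in>{..card A}. m \<noteq> m' \<longrightarrow> reps A {} 0 0 m \<inter> reps A {} 0 0 m' = {}"
    proof (intro ballI impI equals0I)
      fix m m' f assume "m \<noteq> m'" "f \<in> reps A {} 0 0 m \<inter> reps A {} 0 0 m'"
      \<comment> \<open>The set of left ends determines the length.\<close>
      then have "{0<..m} = {0<..m'}" using reps_images(1) by blast
      then have "card {0<..m} = card {0<..m'}" by simp
      with \<open>m \<noteq> m'\<close> show False by simp
    qed
  qed (use assms finite_reps in auto)
  ultimately show ?thesis by (simp add: card_image)
qed

theorem corollary16: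
  fixes n :: nat
  assumes "n \<ge> 1"
  shows "int (card (labeled_interval_orders n)) =
    (\<Sum>S\<in>Pow {1..n - 1}.
       det (binom_matrix n S) *
       (\<Prod>r=1..card S + 1. int r ^ (breakpoint n S r - breakpoint n S (r - 1))))"
proof -
  have "real (card (labeled_interval_orders n)) = (\<Sum>m\<le>n. real (card (reps {1..n} {} 0 0 m)))"
    using card_interval_orders [of "{1..n}"] by (simp add: labeled_interval_orders_def)
  \<comment> \<open>No label is free at the start, hence \<open>q = 0\<close>.\<close>
  also have "\<dots> = fact n * (\<Sum>m\<le>n. rep_egf m 0 $ n)"
    using card_reps [of "{1..n}" "{}" 0] by (simp add: sum_distrib_left)
  also have "\<dots> = fact n * (\<Sum>m\<le>n. fish m $ n)"
    by (simp add: sum_rep_egf)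
  also have "\<dots> = real_of_int (descent_sum n 0 0 1)"
    using assms descent_sum_eq_sum_fish [of n] by (simp add: sum_distrib_left)
  finally have "int (card (labeled_interval_orders n)) = descent_sum n 0 0 1"
    by linarith
  then show ?thesis by (simp only: rhs_eq_descent_sum)
qed

end
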